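(* Let $X$ be a quandle whose set of orbits $\mathrm{Orb}(X)$ is finite, put $m=|\mathrm{Orb}(X)|$, and let $\pi: X\to \mathrm{Orb}(X)=T_m$ be the projection from $X$ to its orbit quandle (a trivial quandle with $m$ elements). Suppose that $X$ is finite, or that there is a quandle homomorphism $s:T_m\to X$ with $\pi\circ s=\mathrm{id}$. Then for every $n\ge 1$ $$\beta_n^{\rm D}(X)\ge a_n,\qquad \beta_n^{\rm R}(X)\ge m^n,\qquad \beta_n^{\rm Q}(X)\ge b_n,$$ where $b_n=m(m-1)^{n-1}$ and $a_n=m^n-b_n$ (with the convention $0^0=1$).
   Context: A quandle is a set $X$ with a binary operation $*$ such that (I) $a*a=a$ for all $a$; (II) for all $a,b$ there is a unique $c$ with $a=c*b$; (III) $(a*b)*c=(a*c)*(b*c)$ for all $a,b,c$. A homomorphism is a map $f$ with $f(a*b)=f(a)*f(b)$. The trivial quandle $T_m$ is the $m$-element set with $x*y=x$. By (II),(III) each map $S(b):a\mapsto a*b$ is an automorphism of $X$; the inner automorphisms are the elements of the group generated by the $S(b)$, $b \in X$. The orbits of $X$ are the orbits of this group; $\mathrm{Orb}(X)$ is the set of orbits, regarded as a trivial quandle (the orbit quandle), and $\pi:X\to\mathrm{Orb}(X)$, $x\mapsto$ its orbit, is a quandle homomorphism. Homology: for $n\ge1$, $C_n^{\rm R}(X)$ is the free abelian group on $n$-tuples $(x_1,\dots,x_n)\in X^n$, and $C_n^{\rm R}(X)=0$ for $n\le 0$; for $n\ge 2$ $$\partial_n(x_1,\dots,x_n)=\sum_{i=2}^n(-1)^i\big[(x_1,\dots,x_{i-1},x_{i+1},\dots,x_n)-(x_1*x_i,\dots,x_{i-1}*x_i,x_{i+1},\dots,x_n)\big],$$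 and $\partial_n=0$ for $n\le1$. $C_n^{\rm D}(X)\subset C_n^{\rm R}(X)$ is the subgroup generated by the tuples with $x_i=x_{i+1}$ for some $i\in\{1,\dots,n-1\}$ if $n\ge2$, and $C_n^{\rm D}(X)=0$ if $n\le1$; it is a subcomplex. $C_n^{\rm Q}(X)=C_n^{\rm R}(X)/C_n^{\rm D}(X)$ with the induced boundary. For ${\rm W}\in\{{\rm D},{\rm R},{\rm Q}\}$, $H_n^{\rm W}(X)=H_n(C_*^{\rm W}(X))$ and $\beta_n^{\rm W}(X)$ is the rank (Betti number, possibly infinite) of $H_n^{\rm W}(X)$. *)

theory Defs
  imports
    "HOL-Algebra.Free_Abelian_Groups"
    "HOL-Algebra.Group_Action"
    "HOL-Library.Extended_Nat"
begin

section \<open>Quandles\<close>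

locale quandle =
  fixes X :: "'a set" and star :: "'a \<Rightarrow> 'a \<Rightarrow> 'a"  (infixl \<open>\<star>\<close> 70)
  assumes star_closed: "\<lbrakk>a \<in> X; b \<in> X\<rbrakk> \<Longrightarrow> a \<star> b \<in> X"
    and idem: "a \<in> X \<Longrightarrow> a \<star> a = a"
    and right_div: "\<lbrakk>a \<in> X; b \<in> X\<rbrakk> \<Longrightarrow> \<exists>!c. c \<in> X \<and> a = c \<star> b"
    and right_distrib: "\<lbrakk>a \<in> X; b \<in> X; c \<in> X\<rbrakk> \<Longrightarrow> (a \<star> b) \<star> c = (a \<star> c) \<star> (b \<star> c)"

definition quandle_hom ::
  "'a set \<Rightarrow> ('a \<Rightarrow> 'a \<Rightarrow> 'a) \<Rightarrow> 'b set \<Rightarrow> ('b \<Rightarrow> 'b \<Rightarrow> 'b) \<Rightarrow> ('a \<Rightarrow> 'b) \<Rightarrow> bool" where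
  "quandle_hom X star Y star' f \<longleftrightarrow>
     f \<in> X \<rightarrow> Y \<and> (\<forall>a\<in>X. \<forall>b\<in>X. f (star a b) = star' (f a) (f b))"

definition trivial_star :: "'a \<Rightarrow> 'a \<Rightarrow> 'a" where
  "trivial_star x y = x"

definition right_translation :: "'a set \<Rightarrow> ('a \<Rightarrow> 'a \<Rightarrow> 'a) \<Rightarrow> 'a \<Rightarrow> 'a \<Rightarrow> 'a" where
  "right_translation X star b = (\<lambda>a\<in>X. star a b)"

definition inner_group :: "'a set \<Rightarrow> ('a \<Rightarrow> 'a \<Rightarrow> 'a) \<Rightarrow> ('a \<Rightarrow> 'a) monoid" where
  "inner_group X star = subgroup_generated (BijGroup X) (right_translation X star ` X)"

definition Orb :: "'a set \<Rightarrow> ('a \<Rightarrow> 'a \<Rightarrow> 'a) \<Rightarrow> 'a set set" where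
  "Orb X star = orbits (inner_group X star) X (\<lambda>g. g)"

definition orb_proj :: "'a set \<Rightarrow> ('a \<Rightarrow> 'a \<Rightarrow> 'a) \<Rightarrow> 'a \<Rightarrow> 'a set" where
  "orb_proj X star x = orbit (inner_group X star) (\<lambda>g. g) x"

section \<open>Rack, degenerate and quandle chain complexes\<close>

text \<open>
  Chain groups are indexed by natural numbers; the groups in negative degrees all vanish and
  are irrelevant for homology in positive degrees. The group in degree \<open>0\<close> is zero as well,
  so its basis is empty instead of consisting of the empty tuple.
\<close>

definition tuples :: "'a set \<Rightarrow> nat \<Rightarrow> 'a list set" where
  "tuples X n = (if n = 0 then {} else {xs. length xs = n \<and> set xs \<subseteq> X})"

definition degenerate_tuples :: "'a set \<Rightarrow> nat \<Rightarrow> 'a list set" where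
  "degenerate_tuples X n = {xs \<in> tuples X n. \<exists>i. Suc i < n \<and> xs ! i = xs ! Suc i}"

definition CR :: "'a set \<Rightarrow> nat \<Rightarrow> ('a list \<Rightarrow>\<^sub>0 int) monoid" where
  "CR X n = free_Abelian_group (tuples X n)"

definition CD :: "'a set \<Rightarrow> nat \<Rightarrow> ('a list \<Rightarrow>\<^sub>0 int) monoid" where
  "CD X n = subgroup_generated (CR X n) (frag_of ` degenerate_tuples X n)"

definition CQ :: "'a set \<Rightarrow> nat \<Rightarrow> ('a list \<Rightarrow>\<^sub>0 int) set monoid" where
  "CQ X n = CR X n Mod carrier (CD X n)"

text \<open>
  For a tuple \<open>xs = (x\<^sub>1, \<dots>, x\<^sub>n)\<close>, the entry \<open>x\<^sub>i\<close> is \<open>xs ! (i - 1)\<close>, the initial part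
  \<open>(x\<^sub>1, \<dots>, x\<^sub>i\<^sub>-\<^sub>1)\<close> is \<open>take (i - 1) xs\<close> and the final part \<open>(x\<^sub>i\<^sub>+\<^sub>1, \<dots>, x\<^sub>n)\<close> is \<open>drop i xs\<close>.
  The sum is empty, hence the boundary zero, in degrees \<open>n \<le> 1\<close>.
\<close>

definition bdR :: "('a \<Rightarrow> 'a \<Rightarrow> 'a) \<Rightarrow> nat \<Rightarrow> ('a list \<Rightarrow>\<^sub>0 int) \<Rightarrow> ('a list \<Rightarrow>\<^sub>0 int)" where
  "bdR star n = frag_extend (\<lambda>xs. \<Sum>i = 2..n. frag_cmul ((- 1) ^ i)
     (frag_of (take (i - 1) xs @ drop i xs)
      - frag_of (map (\<lambda>x. star x (xs ! (i - 1))) (take (i - 1) xs) @ drop i xs)))"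

text \<open>
  The boundary induced on cosets. The boundary preserves the degenerate subcomplex, so all
  members of the union are the same coset.
\<close>

definition bdQ ::
  "'a set \<Rightarrow> ('a \<Rightarrow> 'a \<Rightarrow> 'a) \<Rightarrow> nat \<Rightarrow> ('a list \<Rightarrow>\<^sub>0 int) set \<Rightarrow> ('a list \<Rightarrow>\<^sub>0 int) set" where
  "bdQ X star n K =
     (\<Union>c\<in>K. carrier (CD X (n - 1)) #>\<^bsub>CR X (n - 1)\<^esub> bdR star n c)"

section \<open>Homology and Betti numbers\<close>

text \<open>
  Here \<open>d n\<close> is the boundary from degree \<open>n\<close> to degree \<open>n - 1\<close>. At \<open>n = 0\<close> the truncated
  subtraction is harmless for complexes that vanish in degree \<open>0\<close>.
\<close>

definition homology :: "(nat \<Rightarrow> 'c monoid) \<Rightarrow> (nat \<Rightarrow> 'c \<Rightarrow> 'c) \<Rightarrow> nat \<Rightarrow> 'c set monoid" where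
  "homology C d n =
     (C n)\<lparr>carrier := kernel (C n) (C (n - 1)) (d n)\<rparr> Mod (d (Suc n) ` carrier (C (Suc n)))"

definition HR :: "'a set \<Rightarrow> ('a \<Rightarrow> 'a \<Rightarrow> 'a) \<Rightarrow> nat \<Rightarrow> ('a list \<Rightarrow>\<^sub>0 int) set monoid" where
  "HR X star = homology (CR X) (bdR star)"

definition HD :: "'a set \<Rightarrow> ('a \<Rightarrow> 'a \<Rightarrow> 'a) \<Rightarrow> nat \<Rightarrow> ('a list \<Rightarrow>\<^sub>0 int) set monoid" where
  "HD X star = homology (CD X) (bdR star)"

definition HQ :: "'a set \<Rightarrow> ('a \<Rightarrow> 'a \<Rightarrow> 'a) \<Rightarrow> nat \<Rightarrow> ('a list \<Rightarrow>\<^sub>0 int) set set monoid" where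
  "HQ X star = homology (CQ X) (bdQ X star)"

definition int_independent :: "('g, 'z) monoid_scheme \<Rightarrow> 'g set \<Rightarrow> bool" where
  "int_independent G S \<longleftrightarrow> finite S \<and> S \<subseteq> carrier G \<and>
     (\<forall>k :: 'g \<Rightarrow> int. (\<Otimes>\<^bsub>G\<^esub>x\<in>S. x [^]\<^bsub>G\<^esub> k x) = \<one>\<^bsub>G\<^esub> \<longrightarrow> (\<forall>x\<in>S. k x = 0))"

text \<open>
  The rank of an abelian group (written multiplicatively), with value \<open>\<infinity>\<close> if there are finite
  independent sets of arbitrarily large size.
\<close>

definition abelian_rank :: "('g, 'z) monoid_scheme \<Rightarrow> enat" where
  "abelian_rank G = (SUP S \<in> Collect (int_independent G). enat (card S))"

definition betti_R :: "'a set \<Rightarrow> ('a \<Rightarrow> 'a \<Rightarrow> 'a) \<Rightarrow> nat \<Rightarrow> enat" where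
  "betti_R X star n = abelian_rank (HR X star n)"

definition betti_D :: "'a set \<Rightarrow> ('a \<Rightarrow> 'a \<Rightarrow> 'a) \<Rightarrow> nat \<Rightarrow> enat" where
  "betti_D X star n = abelian_rank (HD X star n)"

definition betti_Q :: "'a set \<Rightarrow> ('a \<Rightarrow> 'a \<Rightarrow> 'a) \<Rightarrow> nat \<Rightarrow> enat" where
  "betti_Q X star n = abelian_rank (HQ X star n)"

text \<open>
  Natural-number subtraction never truncates below: for \<open>n \<ge> 1\<close> we have \<open>b_seq m n \<le> m ^ n\<close>,
  and for \<open>m = 0\<close> (the empty quandle) the factor \<open>m\<close> makes \<open>b_seq\<close> vanish.
\<close>

definition b_seq :: "nat \<Rightarrow> nat \<Rightarrow> nat" where
  "b_seq m n = m * (m - 1) ^ (n - 1)"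

definition a_seq :: "nat \<Rightarrow> nat \<Rightarrow> nat" where
  "a_seq m n = m ^ n - b_seq m n"

end

theory Submission
  imports Defs
begin

text \<open>
  Acting on an entry of a tuple does not change its orbit, so replacing all entries of tuples by
  their orbits is a chain map to the complex of the trivial quandle \<open>Orb X\<close>, whose boundary
  vanishes. Hence the coefficient of every tuple of orbits is a homomorphism on chains that vanishes
  on boundaries, and it suffices to find, for each tuple \<open>A\<close> of orbits, a cycle over \<open>A\<close>. Both
  hypotheses provide a finite subquandle \<open>R\<close> meeting every orbit: \<open>R = X\<close>, or the image of the
  section. Let \<open>S\<close> be the set of tuples in \<open>R\<close> over \<open>A\<close> that repeat consecutive entries wherever
  \<open>A\<close> does. It is permuted by \<open>(x\<^sub>1, \<dots>, x\<^sub>n) \<mapsto> (x\<^sub>1 \<star> x\<^sub>i, \<dots>, x\<^sub>i\<^sub>-\<^sub>1 \<star> x\<^sub>i, x\<^sub>i, \<dots>, x\<^sub>n)\<close>, so the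
  two \<open>i\<close>-th faces of the sum of \<open>S\<close> cancel and the sum is a cycle, which is degenerate if \<open>A\<close> is.
\<close>

section \<open>Lower bounds for ranks\<close>

lemma (in comm_group) hom_integer_group_finprod:
  assumes \<phi>: "\<phi> \<in> hom G integer_group" and S: "finite S" "f \<in> S \<rightarrow> carrier G"
  shows "\<phi> (finprod G f S) = (\<Sum>x\<in>S. \<phi> (f x))"
proof -
  interpret \<phi>: group_hom G integer_group \<phi>
    by (intro group_hom.intro group_hom_axioms.intro is_group group_integer_group \<phi>)
  show ?thesis
    using S by (induction S) (use \<phi>.hom_one \<phi>.hom_mult in auto)
qed

text \<open>Applying \<open>\<phi> i\<close> to a relation among the \<open>c j\<close> leaves only
  \<open>k (c i) * \<phi> i (c i) = 0\<close>, so the exponent of \<open>c i\<close> vanishes.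
  Integer-valued homomorphisms thus detect independence even if \<open>G\<close> has
  torsion.\<close>

lemma (in comm_group) abelian_rank_ge:
  assumes I: "finite I"
    and \<phi>: "\<And>i. i \<in> I \<Longrightarrow> \<phi> i \<in> hom G integer_group"
    and c: "\<And>i. i \<in> I \<Longrightarrow> c i \<in> carrier G"
    and diag: "\<And>i. i \<in> I \<Longrightarrow> \<phi> i (c i) \<noteq> 0"
    and off: "\<And>i j. \<lbrakk>i \<in> I; j \<in> I; i \<noteq> j\<rbrakk> \<Longrightarrow> \<phi> i (c j) = 0"
  shows "enat (card I) \<le> abelian_rank G"
proof -
  \<comment> \<open>The rank counts independent sets, not families, so distinct indices must give
    distinct elements; a coincidence \<open>c i = c j\<close> would contradict \<open>diag\<close>
    and \<open>off\<close>.\<close>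
  have inj: "inj_on c I"
    by (metis diag inj_onI off)
  have "int_independent G (c ` I)"
    unfolding int_independent_def
  proof (intro conjI allI impI ballI)
    fix k :: "'a \<Rightarrow> int" and x
    assume prod: "(\<Otimes>y\<in>c ` I. y [^] k y) = \<one>" and "x \<in> c ` I"
    then obtain i where i: "i \<in> I" "x = c i" by blast
    interpret \<phi>: group_hom G integer_group "\<phi> i"
      using \<phi>[OF i(1)] group_integer_group is_group
      by (simp add: group_hom_def group_hom_axioms_def)
    have "0 = \<phi> i (\<Otimes>y\<in>c ` I. y [^] k y)"
      using prod \<phi>.hom_one by simp
    also have "\<dots> = (\<Sum>y\<in>c ` I. \<phi> i (y [^] k y))"
      by (rule hom_integer_group_finprod) (use \<phi> i c I in auto)
    also have "\<dots> = (\<Sum>j\<in>I. \<phi> i (c j [^] k (c j)))"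
      by (simp add: sum.reindex[OF inj])
    also have "\<dots> = (\<Sum>j\<in>I. k (c j) * \<phi> i (c j))"
      by (rule sum.cong) (use c in \<open>auto simp: \<phi>.hom_int_pow\<close>)
    also have "\<dots> = k (c i) * \<phi> i (c i)"
    proof -
      have "(\<Sum>j\<in>I - {i}. k (c j) * \<phi> i (c j)) = 0"
        by (rule sum.neutral) (metis DiffE insertI1 mult_zero_right off[OF i(1)])
      then show ?thesis
        by (simp add: sum.remove[OF I i(1)])
    qed
    finally show "k x = 0"
      using diag i by auto
  qed (use I c in auto)
  then have "enat (card (c ` I)) \<le> abelian_rank G"
    unfolding abelian_rank_def by (intro SUP_upper) simp
  then show ?thesis
    by (simp add: card_image inj)
qed

text \<open>Functionals that vanish on \<open>N\<close> factor through \<open>G Mod N\<close> and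
  keep their values on the cosets of the \<open>c i\<close>, so the diagonal criterion applies
  there.\<close>

lemma (in comm_group) abelian_rank_subquotient_ge:
  assumes Z: "subgroup Z G" and N: "subgroup N G"
    and I: "finite I"
    and \<phi>: "\<And>i. i \<in> I \<Longrightarrow> \<phi> i \<in> hom G integer_group"
    and \<phi>N: "\<And>i x. \<lbrakk>i \<in> I; x \<in> N\<rbrakk> \<Longrightarrow> \<phi> i x = 0"
    and c: "\<And>i. i \<in> I \<Longrightarrow> c i \<in> Z"
    and diag: "\<And>i. i \<in> I \<Longrightarrow> \<phi> i (c i) \<noteq> 0"
    and off: "\<And>i j. \<lbrakk>i \<in> I; j \<in> I; i \<noteq> j\<rbrakk> \<Longrightarrow> \<phi> i (c j) = 0"
  shows "enat (card I) \<le> abelian_rank (G\<lparr>carrier := Z\<rparr> Mod N)"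
proof -
  have normal: "N \<lhd> G"
    by (simp add: N normal_iff_subgroup)
  define Q where "Q = G Mod N"
  interpret Q: comm_group Q
    unfolding Q_def by (rule abelian_FactGroup[OF N])
  interpret proj: group_hom G Q "\<lambda>x. N #> x"
    using normal.r_coset_hom_Mod[OF normal] Q.is_group is_group
    by (simp add: group_hom_def group_hom_axioms_def Q_def)
  define W where "W = (\<lambda>x. N #> x) ` Z"
  have W: "subgroup W Q"
    unfolding W_def by (rule proj.subgroup_img_is_subgroup[OF Z])
  \<comment> \<open>Cosets and products are computed in \<open>Z\<close> as in \<open>G\<close>, so
    the subquotient is the image of \<open>Z\<close> in \<open>G Mod N\<close>, to which the
    factored functionals restrict.\<close>
  have eq: "G\<lparr>carrier := Z\<rparr> Mod N = Q\<lparr>carrier := W\<rparr>"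
    by (auto simp: Q_def W_def FactGroup_def RCOSETS_def r_coset_def set_mult_def fun_eq_iff)
  interpret W: comm_group "Q\<lparr>carrier := W\<rparr>"
    using group.group_comm_groupI[OF subgroup.subgroup_is_group[OF W Q.is_group]]
      subgroup.subset[OF W] Q.m_comm by (simp add: subset_iff)
  have "\<exists>g. g \<in> hom Q integer_group \<and> (\<forall>x\<in>carrier G. g (N #> x) = \<phi> i x)" if "i \<in> I" for i
  proof -
    interpret \<phi>: group_hom G integer_group "\<phi> i"
      using \<phi>[OF that] group_integer_group is_group
      by (simp add: group_hom_def group_hom_axioms_def)
    have "N \<subseteq> kernel G integer_group (\<phi> i)"
      using \<phi>N[OF that] subgroup.subset[OF N] by (auto simp: kernel_def)
    then show ?thesis
      using \<phi>.FactGroup_universal_kernel[OF normal] unfolding Q_def by metis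
  qed
  then obtain \<psi> where \<psi>: "\<And>i. i \<in> I \<Longrightarrow> \<psi> i \<in> hom Q integer_group"
    "\<And>i x. \<lbrakk>i \<in> I; x \<in> carrier G\<rbrakk> \<Longrightarrow> \<psi> i (N #> x) = \<phi> i x"
    by metis
  have cG: "c i \<in> carrier G" if "i \<in> I" for i
    using c[OF that] subgroup.subset[OF Z] by blast
  show ?thesis
    unfolding eq
  proof (rule W.abelian_rank_ge[OF I, of \<psi> "\<lambda>i. N #> c i"])
    show "\<psi> i \<in> hom (Q\<lparr>carrier := W\<rparr>) integer_group" if "i \<in> I" for i
      using \<psi>(1)[OF that] subgroup.subset[OF W] by (auto simp: hom_def Pi_iff subset_iff)
    show "N #> c i \<in> carrier (Q\<lparr>carrier := W\<rparr>)" if "i \<in> I" for i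
      using c[OF that] by (simp add: W_def)
  qed (use \<psi>(2) cG diag off in auto)
qed

text \<open>Cycles modulo boundaries are a subquotient of \<open>C n\<close>. Keeping groups and
  boundaries abstract lets the rack, degenerate and quandle cases share this criterion.\<close>

lemma abelian_rank_homology_ge:
  assumes groups: "comm_group (C n)" "group (C (n - 1))" "group (C (Suc n))"
    and d: "d n \<in> hom (C n) (C (n - 1))" "d (Suc n) \<in> hom (C (Suc n)) (C n)"
    and I: "finite I"
    and \<phi>: "\<And>i. i \<in> I \<Longrightarrow> \<phi> i \<in> hom (C n) integer_group"
    and \<phi>d: "\<And>i x. \<lbrakk>i \<in> I; x \<in> carrier (C (Suc n))\<rbrakk> \<Longrightarrow> \<phi> i (d (Suc n) x) = 0"
    and c: "\<And>i. i \<in> I \<Longrightarrow> c i \<in> carrier (C n)" "\<And>i. i \<in> I \<Longrightarrow> d n (c i) = \<one>\<^bsub>C (n - 1)\<^esub>"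
    and diag: "\<And>i. i \<in> I \<Longrightarrow> \<phi> i (c i) \<noteq> 0"
    and off: "\<And>i j. \<lbrakk>i \<in> I; j \<in> I; i \<noteq> j\<rbrakk> \<Longrightarrow> \<phi> i (c j) = 0"
  shows "enat (card I) \<le> abelian_rank (homology C d n)"
proof -
  interpret comm_group "C n" by (rule groups)
  interpret d: group_hom "C n" "C (n - 1)" "d n"
    using groups d is_group by (simp add: group_hom_def group_hom_axioms_def)
  interpret d': group_hom "C (Suc n)" "C n" "d (Suc n)"
    using groups d is_group by (simp add: group_hom_def group_hom_axioms_def)
  show ?thesis
    unfolding homology_def
    by (rule abelian_rank_subquotient_ge[OF d.subgroup_kernel d'.img_is_subgroup I \<phi>, of _ c])
       (use \<phi>d c diag off in \<open>auto simp: kernel_def\<close>)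
qed

section \<open>Free abelian groups\<close>

lemma frag_extend_hom:
  assumes "\<And>x. x \<in> S \<Longrightarrow> Poly_Mapping.keys (f x) \<subseteq> T"
  shows "frag_extend f \<in> hom (free_Abelian_group S) (free_Abelian_group T)"
proof (rule homI)
  fix c assume "c \<in> carrier (free_Abelian_group S)"
  then show "frag_extend f c \<in> carrier (free_Abelian_group T)"
    using assms keys_frag_extend[of f c] by fastforce
qed (simp add: frag_extend_add)

lemma lookup_hom_integer_group:
  "(\<lambda>c. Poly_Mapping.lookup (frag_extend f c) a) \<in> hom (free_Abelian_group S) integer_group"
  by (rule homI) (simp_all add: frag_extend_add lookup_add)

text \<open>Chains supported in \<open>D\<close> form a subgroup containing the generators, and each
  of them is built from generators by differences. Membership in the degenerate complex thereby
  becomes a condition on keys.\<close>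

lemma subgroup_generated_free_Abelian_group:
  assumes "D \<subseteq> S"
  shows "subgroup_generated (free_Abelian_group S) (frag_of ` D) = free_Abelian_group D"
proof -
  interpret group "free_Abelian_group S" by simp
  have "generate (free_Abelian_group S) (frag_of ` D) = {c. Poly_Mapping.keys c \<subseteq> D}"
  proof
    have sub: "subgroup {c. Poly_Mapping.keys c \<subseteq> D} (free_Abelian_group S)"
    proof (rule subgroupI)
      show "{c. Poly_Mapping.keys c \<subseteq> D} \<noteq> {}"
        by (auto intro!: exI[of _ 0])
    qed (use assms keys_add in \<open>fastforce+\<close>)
    show "generate (free_Abelian_group S) (frag_of ` D) \<subseteq> {c. Poly_Mapping.keys c \<subseteq> D}"
      by (rule generate_subgroup_incl[OF _ sub]) auto
    have gen: "subgroup (generate (free_Abelian_group S) (frag_of ` D)) (free_Abelian_group S)"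
      by (rule generate_is_subgroup) (use assms in auto)
    show "{c. Poly_Mapping.keys c \<subseteq> D} \<subseteq> generate (free_Abelian_group S) (frag_of ` D)"
    proof clarify
      fix c :: "'a \<Rightarrow>\<^sub>0 int" assume "Poly_Mapping.keys c \<subseteq> D"
      then show "c \<in> generate (free_Abelian_group S) (frag_of ` D)"
      proof (induction rule: frag_induction)
        case zero
        show ?case using subgroup.one_closed[OF gen] by simp
      next
        case (one x)
        then show ?case by (auto intro: generate.incl)
      next
        case (diff a b)
        then have "Poly_Mapping.keys b \<subseteq> S"
          using subgroup.subset[OF gen] by fastforce
        then show ?case
          using subgroup.m_closed[OF gen diff(1) subgroup.m_inv_closed[OF gen diff(2)]] by simp
      qed
    qed
  qed
  \<comment> \<open>\<open>subgroup_generated\<close> intersects the generators with the carrier;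
    here this changes nothing.\<close>
  moreover have "carrier (free_Abelian_group S) \<inter> frag_of ` D = frag_of ` D"
    using assms by auto
  ultimately show ?thesis
    by (simp add: subgroup_generated_def) (simp add: free_Abelian_group_def)
qed

section \<open>Degenerate and quandle chain groups\<close>

lemma CD_eq: "CD X n = free_Abelian_group (degenerate_tuples X n)"
  unfolding CD_def CR_def
  by (rule subgroup_generated_free_Abelian_group) (auto simp: degenerate_tuples_def)

lemma subgroup_CD: "subgroup (carrier (CD X n)) (CR X n)"
  unfolding CD_def CR_def by (intro group.subgroup_subgroup_generated group_free_Abelian_group)

lemma comm_group_CR: "comm_group (CR X n)"
  by (simp add: CR_def abelian_free_Abelian_group)

lemma comm_group_CD: "comm_group (CD X n)"
  by (simp add: CD_eq abelian_free_Abelian_group)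

lemma comm_group_CQ: "comm_group (CQ X n)"
  unfolding CQ_def by (rule comm_group.abelian_FactGroup[OF comm_group_CR subgroup_CD])

text \<open>The universal property of the quotient by degenerate chains; it serves to carry
  coefficients of nondegenerate orbit tuples over to quandle chains.\<close>

lemma CQ_universal:
  assumes "group H" "h \<in> hom (CR X n) H" "\<And>c. c \<in> carrier (CD X n) \<Longrightarrow> h c = \<one>\<^bsub>H\<^esub>"
  obtains g where "g \<in> hom (CQ X n) H"
    "\<And>c. c \<in> carrier (CR X n) \<Longrightarrow> g (carrier (CD X n) #>\<^bsub>CR X n\<^esub> c) = h c"
proof -
  interpret C: comm_group "CR X n" by (rule comm_group_CR)
  interpret h: group_hom "CR X n" H h
    by (intro group_hom.intro group_hom_axioms.intro C.is_group assms(1,2))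
  have "carrier (CD X n) \<lhd> CR X n"
    by (simp add: C.normal_iff_subgroup subgroup_CD)
  moreover have "carrier (CD X n) \<subseteq> kernel (CR X n) H h"
    using assms(3) subgroup.subset[OF subgroup_CD] by (auto simp: kernel_def)
  ultimately show thesis
    by (rule h.FactGroup_universal_kernel) (use that in \<open>simp_all add: CQ_def\<close>)
qed

section \<open>Counting tuples\<close>

lemma tuples_eq_lists: "n \<ge> 1 \<Longrightarrow> tuples X n = {xs. set xs \<subseteq> X \<and> length xs = n}"
  by (auto simp: tuples_def)

lemma finite_tuples: "finite X \<Longrightarrow> finite (tuples X n)"
  by (cases n) (simp_all add: tuples_eq_lists finite_lists_length_eq, simp add: tuples_def)

lemma card_tuples: "finite X \<Longrightarrow> n \<ge> 1 \<Longrightarrow> card (tuples X n) = card X ^ n"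
  by (simp add: tuples_eq_lists card_lists_length_eq)

text \<open>Gives access to the rules of \<open>distinct_adj\<close> for \<open>Cons\<close>, used
  in counting, and for \<open>map\<close>, used in passing to orbits.\<close>

lemma degenerate_tuples_eq: "degenerate_tuples X n = {xs \<in> tuples X n. \<not> distinct_adj xs}"
  by (auto simp: degenerate_tuples_def distinct_adj_conv_nth tuples_def)

text \<open>Tuples are built by prepending entries: each new head may be anything but the previous
  one, which gives a factor \<open>card X - 1\<close>. For empty \<open>X\<close> both sides are
  zero.\<close>

lemma card_distinct_adj_tuples:
  assumes "finite X"
  shows "card {xs \<in> tuples X (Suc k). distinct_adj xs} = card X * (card X - 1) ^ k"
proof (induction k)
  case 0
  have "{xs \<in> tuples X (Suc 0). distinct_adj xs} = (\<lambda>x. [x]) ` X"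
    by (auto simp: tuples_def length_Suc_conv)
  then show ?case
    by (simp add: card_image inj_on_def)
next
  case (Suc k)
  let ?A = "\<lambda>k. {xs \<in> tuples X (Suc k). distinct_adj xs}"
  \<comment> \<open>The tail comes first in the pair because the forbidden value of the new head
    depends on it.\<close>
  have "?A (Suc k) = (\<lambda>(ys, x). x # ys) ` (SIGMA ys:?A k. X - {hd ys})" (is "_ = ?f ` ?B")
  proof
    show "?A (Suc k) \<subseteq> ?f ` ?B"
    proof
      fix xs assume xs: "xs \<in> ?A (Suc k)"
      then obtain x ys where eq: "xs = x # ys" "length ys = Suc k"
        by (auto simp: tuples_def length_Suc_conv)
      then have "(ys, x) \<in> ?B"
        using xs by (auto simp: tuples_def distinct_adj_Cons)
      then show "xs \<in> ?f ` ?B"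
        using eq by force
    qed
    show "?f ` ?B \<subseteq> ?A (Suc k)"
      by (auto simp: tuples_def distinct_adj_Cons)
  qed
  moreover have "inj_on ?f ?B"
    by (auto simp: inj_on_def)
  ultimately have "card (?A (Suc k)) = card ?B"
    by (simp add: card_image)
  also have "\<dots> = (\<Sum>ys\<in>?A k. card (X - {hd ys}))"
    using assms by (intro card_SigmaI) (auto intro: finite_subset[OF _ finite_tuples])
  also have "\<dots> = (\<Sum>ys\<in>?A k. card X - 1)"
  proof (rule sum.cong)
    fix ys assume "ys \<in> ?A k"
    then have "hd ys \<in> X"
      by (cases ys) (auto simp: tuples_def)
    then show "card (X - {hd ys}) = card X - 1" by simp
  qed simp
  also have "\<dots> = card X * (card X - 1) ^ Suc k"
    by (simp add: Suc.IH)
  finally show ?case .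
qed

lemma card_nondegenerate_tuples:
  assumes "finite X" "n \<ge> 1"
  shows "card (tuples X n - degenerate_tuples X n) = b_seq (card X) n"
proof -
  obtain k where "n = Suc k"
    using assms(2) by (cases n) auto
  moreover have "tuples X n - degenerate_tuples X n = {xs \<in> tuples X n. distinct_adj xs}"
    by (auto simp: degenerate_tuples_eq)
  ultimately show ?thesis
    using card_distinct_adj_tuples[OF assms(1)] by (simp add: b_seq_def)
qed

lemma card_degenerate_tuples:
  assumes "finite X" "n \<ge> 1"
  shows "card (degenerate_tuples X n) = a_seq (card X) n"
proof -
  have sub: "degenerate_tuples X n \<subseteq> tuples X n"
    by (auto simp: degenerate_tuples_def)
  have "card (tuples X n - degenerate_tuples X n) = card (tuples X n) - card (degenerate_tuples X n)"
    by (intro card_Diff_subset finite_subset[OF sub] sub finite_tuples assms)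
  moreover have "card (degenerate_tuples X n) \<le> card (tuples X n)"
    by (intro card_mono sub finite_tuples assms)
  ultimately show ?thesis
    using assms by (simp add: a_seq_def card_tuples flip: card_nondegenerate_tuples)
qed

section \<open>The boundary operator\<close>

lemma bdR_frag_of:
  "bdR star n (frag_of xs) = (\<Sum>i = 2..n. frag_cmul ((- 1) ^ i)
     (frag_of (take (i - 1) xs @ drop i xs)
      - frag_of (map (\<lambda>x. star x (xs ! (i - 1))) (take (i - 1) xs) @ drop i xs)))"
  by (simp add: bdR_def)

lemma bdR_add: "bdR star n (c + d) = bdR star n c + bdR star n d"
  by (simp add: bdR_def frag_extend_add)

text \<open>The map \<open>f\<close> covers both kinds of faces: it is the identity for the first
  and a right translation for the second.\<close>

lemma face_in_tuples:
  assumes "xs \<in> tuples X n" "i \<in> {2..n}" "f ` X \<subseteq> X"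
  shows "map f (take (i - 1) xs) @ drop i xs \<in> tuples X (n - 1)"
  using assms set_take_subset[of "i - 1" xs] set_drop_subset[of i xs]
  by (fastforce simp: tuples_def image_subset_iff)

text \<open>The equal pair survives: it moves down one place if an earlier entry is deleted, and
  otherwise both members are changed by the same \<open>f\<close>. Since \<open>i\<close> counts
  from one and \<open>p\<close> from zero, the excluded values of \<open>i\<close> are those that
  delete a member of the pair.\<close>

lemma face_in_degenerate_tuples:
  assumes xs: "xs \<in> tuples X n" and p: "Suc p < n" "xs ! p = xs ! Suc p"
    and i: "i \<in> {2..n}" "i \<noteq> p + 1" "i \<noteq> p + 2" and f: "f ` X \<subseteq> X"
  shows "map f (take (i - 1) xs) @ drop i xs \<in> degenerate_tuples X (n - 1)"
proof -
  let ?ys = "map f (take (i - 1) xs) @ drop i xs"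
  have len: "length xs = n"
    using xs p by (simp add: tuples_def)
  have "\<exists>q. Suc q < n - 1 \<and> ?ys ! q = ?ys ! Suc q"
  proof (cases "i \<le> p")
    case True
    then have "?ys ! (p - 1) = xs ! p" "?ys ! Suc (p - 1) = xs ! Suc p"
      using i p len by (auto simp: nth_append min_def)
    then show ?thesis
      using True i p by (intro exI[of _ "p - 1"]) auto
  next
    case False
    then have "?ys ! p = f (xs ! p)" "?ys ! Suc p = f (xs ! Suc p)"
      using i p len by (auto simp: nth_append min_def)
    then show ?thesis
      using False i p by (intro exI[of _ p]) auto
  qed
  then show ?thesis
    using face_in_tuples[OF xs i(1) f] by (auto simp: degenerate_tuples_def)
qed

lemma keys_signed_diff:
  "Poly_Mapping.keys (frag_cmul k (frag_of a - frag_of b)) \<subseteq> {a, b}"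
  using keys_cmul[of k "frag_of a - frag_of b"] keys_diff[of "frag_of a" "frag_of b"] by auto

context quandle
begin

lemma right_translation_inj: "\<lbrakk>a \<in> X; b \<in> X; c \<in> X; a \<star> c = b \<star> c\<rbrakk> \<Longrightarrow> a = b"
  using right_div[of "a \<star> c" c] star_closed[of a c] by metis

lemma keys_bdR_tuple:
  assumes "xs \<in> tuples X n"
  shows "Poly_Mapping.keys (bdR (\<star>) n (frag_of xs)) \<subseteq> tuples X (n - 1)"
  unfolding bdR_frag_of
proof (rule order_trans[OF keys_sum], rule UN_least, rule order_trans[OF keys_signed_diff])
  fix i assume i: "i \<in> {2..n}"
  then have "xs ! (i - 1) \<in> X"
    using assms by (auto simp: tuples_def subset_iff)
  then have "(\<lambda>x. x \<star> xs ! (i - 1)) ` X \<subseteq> X"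
    using star_closed by auto
  then show "{take (i - 1) xs @ drop i xs,
      map (\<lambda>x. x \<star> xs ! (i - 1)) (take (i - 1) xs) @ drop i xs} \<subseteq> tuples X (n - 1)"
    using face_in_tuples[OF assms i] face_in_tuples[OF assms i, of "\<lambda>x. x"] by simp
qed

text \<open>If the entries at positions \<open>p\<close> and \<open>p + 1\<close> agree, then the terms \<open>i = p + 1\<close> and
  \<open>i = p + 2\<close> of the boundary cancel and all the others are degenerate. The sum is first extended
  by the vanishing term \<open>i = 1\<close>, which is needed for \<open>p = 0\<close>.\<close>

lemma keys_bdR_degenerate_tuple:
  assumes "xs \<in> degenerate_tuples X n"
  shows "Poly_Mapping.keys (bdR (\<star>) n (frag_of xs)) \<subseteq> degenerate_tuples X (n - 1)"
proof -
  obtain p where xs: "xs \<in> tuples X n" and p: "Suc p < n" "xs ! p = xs ! Suc p"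
    using assms by (auto simp: degenerate_tuples_def)
  have len: "length xs = n"
    using xs p by (simp add: tuples_def)
  define F where "F = (\<lambda>i. frag_cmul ((- 1) ^ i) (frag_of (take (i - 1) xs @ drop i xs)
      - frag_of (map (\<lambda>x. x \<star> xs ! (i - 1)) (take (i - 1) xs) @ drop i xs)))"
  have entry: "xs ! j \<in> X" if "j < n" for j
    using xs that p by (auto simp: tuples_def subset_iff)
  \<comment> \<open>Nothing precedes the first entry, so there is nothing to act on and the two
    faces coincide.\<close>
  have "F 1 = 0"
    by (simp add: F_def)
  \<comment> \<open>Deleting either copy leaves the same tuple. The second faces agree too: the
    translating elements are equal, and idempotence fixes the surviving copy. The signs are
    opposite.\<close>
  have cancel: "F (p + 1) + F (p + 2) = 0"
  proof -
    have take: "take (p + 1) xs = take p xs @ [xs ! p]" and drop: "drop (p + 1) xs = xs ! p # drop (p + 2) xs"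
      using len p by (simp_all add: take_Suc_conv_app_nth Cons_nth_drop_Suc)
    have "xs ! p \<star> xs ! p = xs ! p"
      using entry p by (simp add: idem)
    then show ?thesis
      using p(2) take drop by (simp add: F_def flip: frag_cmul_distrib)
  qed
  have "bdR (\<star>) n (frag_of xs) = sum F {2..n}"
    by (simp add: bdR_frag_of F_def)
  also have "\<dots> = sum F {1..n}"
  proof -
    have "{1..n} = insert 1 {2..n}"
      using p by auto
    then show ?thesis
      using \<open>F 1 = 0\<close> by simp
  qed
  also have "\<dots> = sum F ({1..n} - {p + 1, p + 2}) + sum F {p + 1, p + 2}"
    using p by (intro sum.subset_diff) auto
  also have "\<dots> = sum F ({1..n} - {p + 1, p + 2})"
    using cancel by simp
  finally have eq: "bdR (\<star>) n (frag_of xs) = sum F ({1..n} - {p + 1, p + 2})" .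
  show ?thesis
    unfolding eq
  proof (rule order_trans[OF keys_sum], rule UN_least)
    fix i assume i: "i \<in> {1..n} - {p + 1, p + 2}"
    show "Poly_Mapping.keys (F i) \<subseteq> degenerate_tuples X (n - 1)"
    proof (cases "i = 1")
      case True
      then show ?thesis using \<open>F 1 = 0\<close> by simp
    next
      case False
      then have i': "i \<in> {2..n}" "i \<noteq> p + 1" "i \<noteq> p + 2"
        using i by auto
      have "(\<lambda>x. x \<star> xs ! (i - 1)) ` X \<subseteq> X"
        using star_closed entry[of "i - 1"] i' by auto
      then have "{take (i - 1) xs @ drop i xs,
          map (\<lambda>x. x \<star> xs ! (i - 1)) (take (i - 1) xs) @ drop i xs} \<subseteq> degenerate_tuples X (n - 1)"
        using face_in_degenerate_tuples[OF xs p i'] face_in_degenerate_tuples[OF xs p i', of "\<lambda>x. x"]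
        by simp
      then show ?thesis
        unfolding F_def by (rule order_trans[OF keys_signed_diff])
    qed
  qed
qed

section \<open>The boundary as a homomorphism on the three complexes\<close>

lemma bdR_hom_CR: "bdR (\<star>) n \<in> hom (CR X n) (CR X (n - 1))"
  unfolding CR_def bdR_def
  by (rule frag_extend_hom) (use keys_bdR_tuple in \<open>simp add: bdR_frag_of\<close>)

lemma bdR_hom_CD: "bdR (\<star>) n \<in> hom (CD X n) (CD X (n - 1))"
  unfolding CD_eq bdR_def
  by (rule frag_extend_hom) (use keys_bdR_degenerate_tuple in \<open>simp add: bdR_frag_of\<close>)

text \<open>Representatives of a coset differ by a degenerate chain, whose boundary is again
  degenerate. Statements about \<open>bdQ\<close> thereby reduce to statements about
  \<open>bdR\<close>.\<close>

lemma bdQ_coset: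
  assumes c: "c \<in> carrier (CR X n)"
  shows "bdQ X (\<star>) n (carrier (CD X n) #>\<^bsub>CR X n\<^esub> c)
    = carrier (CD X (n - 1)) #>\<^bsub>CR X (n - 1)\<^esub> bdR (\<star>) n c"
proof -
  let ?C = "CR X (n - 1)" and ?D = "carrier (CD X (n - 1))"
  interpret C: comm_group ?C by (rule comm_group_CR)
  have "?D #>\<^bsub>?C\<^esub> bdR (\<star>) n (d + c) = ?D #>\<^bsub>?C\<^esub> bdR (\<star>) n c" if "d \<in> carrier (CD X n)" for d
  proof -
    have d: "bdR (\<star>) n d \<in> ?D"
      using hom_in_carrier[OF bdR_hom_CD that] .
    have "bdR (\<star>) n (d + c) = bdR (\<star>) n d \<otimes>\<^bsub>?C\<^esub> bdR (\<star>) n c"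
      by (simp add: bdR_add CR_def)
    then have "bdR (\<star>) n (d + c) \<in> ?D #>\<^bsub>?C\<^esub> bdR (\<star>) n c"
      using d by (auto simp: r_coset_def)
    then show ?thesis
      using C.repr_independence[OF _ hom_in_carrier[OF bdR_hom_CR c] subgroup_CD] by blast
  qed
  \<comment> \<open>The union of equal cosets is that coset only if it is taken over a nonempty
    set.\<close>
  moreover have "0 \<in> carrier (CD X n)"
    by (simp add: CD_eq)
  moreover have "carrier (CD X n) #>\<^bsub>CR X n\<^esub> c = (\<lambda>d. d + c) ` carrier (CD X n)"
    by (auto simp: r_coset_def CR_def)
  ultimately show ?thesis
    unfolding bdQ_def by auto
qed

lemma bdQ_hom: "bdQ X (\<star>) n \<in> hom (CQ X n) (CQ X (n - 1))"
proof (rule homI)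
  have normal: "carrier (CD X k) \<lhd> CR X k" for k
    using comm_group.normal_iff_subgroup[OF comm_group_CR] subgroup_CD by blast
  fix K assume "K \<in> carrier (CQ X n)"
  then obtain a where a: "a \<in> carrier (CR X n)" "K = carrier (CD X n) #>\<^bsub>CR X n\<^esub> a"
    by (auto simp: CQ_def carrier_FactGroup)
  show "bdQ X (\<star>) n K \<in> carrier (CQ X (n - 1))"
    using bdQ_coset[OF a(1)] hom_in_carrier[OF bdR_hom_CR a(1)] a(2)
    by (auto simp: CQ_def carrier_FactGroup)
  fix L assume "L \<in> carrier (CQ X n)"
  then obtain b where b: "b \<in> carrier (CR X n)" "L = carrier (CD X n) #>\<^bsub>CR X n\<^esub> b"
    by (auto simp: CQ_def carrier_FactGroup)
  interpret C: group "CR X n" by (rule comm_group.axioms(2)[OF comm_group_CR])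
  show "bdQ X (\<star>) n (K \<otimes>\<^bsub>CQ X n\<^esub> L) = bdQ X (\<star>) n K \<otimes>\<^bsub>CQ X (n - 1)\<^esub> bdQ X (\<star>) n L"
    using a b hom_in_carrier[OF bdR_hom_CR] hom_mult[OF bdR_hom_CR]
    by (simp add: CQ_def normal.rcos_sum[OF normal] bdQ_coset)
qed

text \<open>Since \<open>p\<close> does not see right translations, the two \<open>i\<close>-th
  faces of a tuple have the same image. Coefficients read off after applying \<open>p\<close>
  therefore vanish on boundaries.\<close>

lemma frag_extend_map_bdR:
  assumes p: "\<And>x y. \<lbrakk>x \<in> X; y \<in> X\<rbrakk> \<Longrightarrow> p (x \<star> y) = p x"
    and c: "Poly_Mapping.keys c \<subseteq> tuples X n"
  shows "frag_extend (frag_of \<circ> map p) (bdR (\<star>) n c) = 0"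
  using c
proof (induction rule: frag_induction)
  case (one xs)
  have face: "map p (map (\<lambda>x. x \<star> xs ! (i - 1)) (take (i - 1) xs) @ drop i xs)
      = map p (take (i - 1) xs @ drop i xs)" if "i \<in> {2..n}" for i
  proof -
    have "xs ! (i - 1) \<in> X" "set (take (i - 1) xs) \<subseteq> X"
      using one that set_take_subset[of "i - 1" xs] by (auto simp: tuples_def subset_iff)
    then show ?thesis
      using p by auto
  qed
  have "frag_extend (frag_of \<circ> map p) (bdR (\<star>) n (frag_of xs))
    = (\<Sum>i = 2..n. frag_cmul ((- 1) ^ i) (frag_of (map p (take (i - 1) xs @ drop i xs))
      - frag_of (map p (map (\<lambda>x. x \<star> xs ! (i - 1)) (take (i - 1) xs) @ drop i xs))))"
    by (simp add: bdR_frag_of frag_extend_sum frag_extend_cmul frag_extend_diff del: map_map map_append)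
  also have "\<dots> = 0"
    by (intro sum.neutral ballI) (simp only: face diff_self frag_cmul_zero2)
  finally show ?case .
qed (simp_all add: bdR_def frag_extend_diff)

text \<open>By idempotence the \<open>j\<close>-th entry may be included in the part of the tuple that is acted on.
  This makes the invariance easier to check for tuples with coincident entries.\<close>

lemma bdR_sum_invariant:
  assumes S: "finite S" "S \<subseteq> tuples X n"
    and inv: "\<And>xs j. \<lbrakk>xs \<in> S; j < n\<rbrakk> \<Longrightarrow>
      map (\<lambda>x. x \<star> xs ! j) (take (Suc j) xs) @ drop (Suc j) xs \<in> S"
  shows "bdR (\<star>) n (\<Sum>xs\<in>S. frag_of xs) = 0"
proof -
  have zero: "(\<Sum>xs\<in>S. frag_of (take j xs @ drop (Suc j) xs)
      - frag_of (map (\<lambda>x. x \<star> xs ! j) (take j xs) @ drop (Suc j) xs)) = 0" if j: "j < n" for j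
  proof -
    \<comment> \<open>Deleting entry \<open>j\<close> from \<open>T xs\<close> gives the second face
      of \<open>xs\<close>, so once \<open>T\<close> permutes \<open>S\<close>, the first and second
      faces have equal sums. Here \<open>j\<close> counts from zero and stands for
      \<open>i - 1\<close>.\<close>
    define T where "T = (\<lambda>xs. map (\<lambda>x. x \<star> xs ! j) (take (Suc j) xs) @ drop (Suc j) xs)"
    have T_eq: "T xs = map (\<lambda>x. x \<star> xs ! j) (take j xs) @ xs ! j # drop (Suc j) xs"
      and len: "length xs = n" and setX: "set xs \<subseteq> X" if "xs \<in> S" for xs
    proof -
      show len: "length xs = n" and setX: "set xs \<subseteq> X"
        using that S(2) j by (auto simp: tuples_def)
      then have "xs ! j \<star> xs ! j = xs ! j"
        using j by (intro idem) auto
      then show "T xs = map (\<lambda>x. x \<star> xs ! j) (take j xs) @ xs ! j # drop (Suc j) xs"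
        using len j by (simp add: T_def take_Suc_conv_app_nth)
    qed
    \<comment> \<open>\<open>T\<close> leaves entry \<open>j\<close> unchanged, so tuples with equal
      images were translated by the same element, and that translation is injective.\<close>
    have inj: "inj_on T S"
    proof (rule inj_onI)
      fix xs ys assume xs: "xs \<in> S" and ys: "ys \<in> S" and "T xs = T ys"
      then have eq: "map (\<lambda>x. x \<star> xs ! j) (take j xs) = map (\<lambda>x. x \<star> ys ! j) (take j ys)"
        "xs ! j = ys ! j" "drop (Suc j) xs = drop (Suc j) ys"
        using j by (auto simp: T_eq len)
      have "inj_on (\<lambda>x. x \<star> xs ! j) X"
        using setX[OF xs] len[OF xs] j right_translation_inj by (intro inj_onI) (meson nth_mem subsetD)
      moreover have "set (take j xs) \<union> set (take j ys) \<subseteq> X"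
        using setX[OF xs] setX[OF ys] by (auto dest: in_set_takeD)
      ultimately have "take j xs = take j ys"
        using eq(1,2) by (metis inj_on_subset inj_on_map_eq_map)
      then show "xs = ys"
        using eq id_take_nth_drop[of j xs] id_take_nth_drop[of j ys] len[OF xs] len[OF ys] j by metis
    qed
    \<comment> \<open>An injective map of a finite set into itself is onto.\<close>
    have "T ` S = S"
      using inv j by (intro card_subset_eq S card_image inj) (auto simp: T_def)
    then have "(\<Sum>xs\<in>S. frag_of (take j xs @ drop (Suc j) xs))
        = (\<Sum>xs\<in>S. frag_of (take j (T xs) @ drop (Suc j) (T xs)))"
      by (metis (no_types, lifting) sum.reindex_cong[OF inj, symmetric])
    also have "\<dots> = (\<Sum>xs\<in>S. frag_of (map (\<lambda>x. x \<star> xs ! j) (take j xs) @ drop (Suc j) xs))"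
      by (rule sum.cong) (use j in \<open>simp_all add: T_eq len\<close>)
    finally show ?thesis
      by (simp add: sum_subtractf)
  qed
  have "bdR (\<star>) n (\<Sum>xs\<in>S. frag_of xs) = (\<Sum>xs\<in>S. bdR (\<star>) n (frag_of xs))"
    by (simp add: bdR_def frag_extend_sum[OF S(1)])
  also have "\<dots> = (\<Sum>i = 2..n. frag_cmul ((- 1) ^ i)
      (\<Sum>xs\<in>S. frag_of (take (i - 1) xs @ drop i xs)
        - frag_of (map (\<lambda>x. x \<star> xs ! (i - 1)) (take (i - 1) xs) @ drop i xs)))"
    unfolding bdR_frag_of frag_cmul_sum by (rule sum.swap)
  also have "\<dots> = 0"
  proof (rule sum.neutral, rule ballI)
    fix i assume "i \<in> {2..n}"
    then have "i - 1 < n" "Suc (i - 1) = i" by auto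
    then show "frag_cmul ((- 1) ^ i) (\<Sum>xs\<in>S. frag_of (take (i - 1) xs @ drop i xs)
        - frag_of (map (\<lambda>x. x \<star> xs ! (i - 1)) (take (i - 1) xs) @ drop i xs)) = 0"
      using zero[of "i - 1"] by (simp only: frag_cmul_zero2)
  qed
  finally show ?thesis .
qed

end

section \<open>Orbits\<close>

context quandle
begin

text \<open>Uniqueness and existence in right division give injectivity and surjectivity. Hence no
  generator is lost when \<open>inner_group\<close> intersects them with the carrier.\<close>

lemma right_translation_Bij:
  assumes "y \<in> X"
  shows "right_translation X (\<star>) y \<in> carrier (BijGroup X)"
proof -
  have "bij_betw (\<lambda>a\<in>X. a \<star> y) X X"
    unfolding bij_betw_def
  proof
    show "inj_on (\<lambda>a\<in>X. a \<star> y) X"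
      using right_translation_inj assms by (auto intro!: inj_onI)
    show "(\<lambda>a\<in>X. a \<star> y) ` X = X"
    proof
      show "X \<subseteq> (\<lambda>a\<in>X. a \<star> y) ` X"
      proof
        fix a assume "a \<in> X"
        then obtain c where "c \<in> X" "a = c \<star> y"
          using right_div[OF _ assms] by blast
        then show "a \<in> (\<lambda>a\<in>X. a \<star> y) ` X"
          by (intro image_eqI[of _ _ c]) simp_all
      qed
    qed (use star_closed assms in auto)
  qed
  then show ?thesis
    by (simp add: right_translation_def BijGroup_def Bij_def)
qed

lemma inner_group_action: "group_action (inner_group X (\<star>)) X (\<lambda>g. g)"
proof (rule group_action.intro)
  interpret B: group "BijGroup X" by (rule group_BijGroup)
  show "group_hom (inner_group X (\<star>)) (BijGroup X) (\<lambda>g. g)"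
    unfolding inner_group_def group_hom_def group_hom_axioms_def
    using B.hom_from_subgroup_generated[of "\<lambda>g. g" "BijGroup X"] by (auto simp: hom_def)
qed

text \<open>The right translation by \<open>y\<close> is an inner automorphism taking
  \<open>x\<close> to \<open>x \<star> y\<close>, so the two points share an orbit.\<close>

lemma orb_proj_star:
  assumes x: "x \<in> X" and y: "y \<in> X"
  shows "orb_proj X (\<star>) (x \<star> y) = orb_proj X (\<star>) x"
proof -
  interpret group_action "inner_group X (\<star>)" X "\<lambda>g. g" by (rule inner_group_action)
  have "right_translation X (\<star>) y \<in> carrier (inner_group X (\<star>))"
    unfolding inner_group_def carrier_subgroup_generated
    using right_translation_Bij[OF y] y by (auto intro: generate.incl)
  then have mem: "x \<star> y \<in> orbit (inner_group X (\<star>)) (\<lambda>g. g) x"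
    unfolding orbit_def
    using x by (intro CollectI exI[of _ "right_translation X (\<star>) y"]) (simp add: right_translation_def)
  have xy: "x \<star> y \<in> X"
    by (rule star_closed[OF x y])
  \<comment> \<open>Transitivity of the orbit relation is applied to points of \<open>X\<close>, so
    orbits must be known to stay inside \<open>X\<close>.\<close>
  have "orbit (inner_group X (\<star>)) (\<lambda>g. g) z \<subseteq> X" if "z \<in> X" for z
    using element_image[OF _ that] by (auto simp: orbit_def)
  then show ?thesis
    unfolding orb_proj_def
    using orbit_trans[OF x xy _ mem] orbit_trans[OF xy x _ orbit_sym[OF x xy mem]] x xy by blast
qed

lemma Orb_eq: "Orb X (\<star>) = orb_proj X (\<star>) ` X"
  by (auto simp: Orb_def orbits_def orb_proj_def)

end

section \<open>Cycles over tuples of orbits\<close>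

text \<open>Imposing the coincidences between consecutive entries of \<open>A\<close> makes the tuples over a
  degenerate \<open>A\<close> degenerate without destroying the invariance needed for a cycle.\<close>

definition lifts :: "('a \<Rightarrow> 'b) \<Rightarrow> 'a set \<Rightarrow> 'b list \<Rightarrow> 'a list set" where
  "lifts p R A = {xs. set xs \<subseteq> R \<and> map p xs = A \<and>
     (\<forall>i. Suc i < length A \<longrightarrow> A ! i = A ! Suc i \<longrightarrow> xs ! i = xs ! Suc i)}"

lemma finite_lifts:
  assumes "finite R"
  shows "finite (lifts p R A)"
  by (rule finite_subset[OF _ finite_lists_length_eq[OF assms, of "length A"]])
     (auto simp: lifts_def)

text \<open>One preimage in \<open>R\<close> is fixed for each value of \<open>p\<close>; using it
  at every occurrence makes the required coincidences automatic.\<close>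

lemma lifts_nonempty:
  assumes "set A \<subseteq> p ` R"
  shows "lifts p R A \<noteq> {}"
proof -
  let ?s = "inv_into R p"
  have "map p (map ?s A) = A"
    using assms by (auto intro!: map_idI simp: f_inv_into_f subset_iff)
  moreover have "set (map ?s A) \<subseteq> R"
    using assms by (auto intro: inv_into_into)
  ultimately have "map ?s A \<in> lifts p R A"
    by (auto simp: lifts_def)
  then show ?thesis by blast
qed

lemma lifts_subset_tuples:
  assumes "R \<subseteq> X" "A \<in> tuples Y n"
  shows "lifts p R A \<subseteq> tuples X n"
  using assms by (auto simp: lifts_def tuples_def split: if_splits)

lemma lifts_subset_degenerate_tuples:
  assumes "R \<subseteq> X" "A \<in> degenerate_tuples Y n"
  shows "lifts p R A \<subseteq> degenerate_tuples X n"
proof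
  fix xs assume xs: "xs \<in> lifts p R A"
  have A: "A \<in> tuples Y n" "length A = n"
    using assms(2) by (auto simp: degenerate_tuples_def tuples_def split: if_splits)
  obtain i where "Suc i < n" "A ! i = A ! Suc i"
    using assms(2) by (auto simp: degenerate_tuples_def)
  then have "Suc i < n \<and> xs ! i = xs ! Suc i"
    using xs A(2) by (auto simp: lifts_def)
  then show "xs \<in> degenerate_tuples X n"
    using lifts_subset_tuples[OF assms(1) A(1)] xs by (auto simp: degenerate_tuples_def)
qed

context quandle
begin

text \<open>Two equal neighbours are both translated by \<open>xs ! j\<close> or both left alone,
  except for the pair at \<open>j\<close> and \<open>Suc j\<close>.\<close>

lemma lifts_invariant:
  assumes p: "\<And>x y. \<lbrakk>x \<in> X; y \<in> X\<rbrakk> \<Longrightarrow> p (x \<star> y) = p x"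
    and R: "R \<subseteq> X" "\<And>x y. \<lbrakk>x \<in> R; y \<in> R\<rbrakk> \<Longrightarrow> x \<star> y \<in> R"
    and xs: "xs \<in> lifts p R A" and j: "j < length A"
  shows "map (\<lambda>x. x \<star> xs ! j) (take (Suc j) xs) @ drop (Suc j) xs \<in> lifts p R A"
proof -
  define ys where "ys = map (\<lambda>x. x \<star> xs ! j) (take (Suc j) xs) @ drop (Suc j) xs"
  have len: "length xs = length A" and setR: "set xs \<subseteq> R" and pxs: "map p xs = A"
    and eqs: "\<And>i. \<lbrakk>Suc i < length A; A ! i = A ! Suc i\<rbrakk> \<Longrightarrow> xs ! i = xs ! Suc i"
    using xs by (auto simp: lifts_def)
  have xR: "xs ! i \<in> R" if "i < length A" for i
    using setR len that by (auto simp: subset_iff)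
  have ys_nth: "ys ! i = (if i \<le> j then xs ! i \<star> xs ! j else xs ! i)" if "i < length A" for i
    using that len j by (auto simp: ys_def nth_append min_def)
  have lenys: "length ys = length A"
    using len by (simp add: ys_def)
  have "ys ! i \<in> R" if "i < length A" for i
    using ys_nth[OF that] xR[OF that] xR[OF j] R(2) by simp
  then have "set ys \<subseteq> R"
    using lenys by (metis (no_types, lifting) in_set_conv_nth subsetI)
  moreover have "map p ys = A"
  proof (rule nth_equalityI)
    fix i assume "i < length (map p ys)"
    then have i: "i < length A" using lenys by simp
    have "p (ys ! i) = p (xs ! i)"
      using ys_nth[OF i] xR[OF i] xR[OF j] R(1) p by auto
    also have "\<dots> = A ! i"
      using pxs i len by (metis nth_map)
    finally show "map p ys ! i = A ! i"
      using i lenys by simp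
  qed (use lenys in simp)
  moreover have "ys ! i = ys ! Suc i" if i: "Suc i < length A" "A ! i = A ! Suc i" for i
  proof (cases "i = j")
    \<comment> \<open>Only the first member of this pair is translated, and it is translated by
      itself, so idempotence leaves it unchanged.\<close>
    case True
    then show ?thesis
      using ys_nth[of i] ys_nth[of "Suc i"] i eqs[OF i] idem xR[OF j] R(1) by auto
  next
    case False
    then show ?thesis
      using ys_nth[of i] ys_nth[of "Suc i"] i eqs[OF i] by auto
  qed
  ultimately show ?thesis
    unfolding ys_def[symmetric] lifts_def by blast
qed

text \<open>All lifts have image \<open>A\<close>. The multiplicity becomes the diagonal entry of
  the pairing of coefficients with cycles, and the other entries vanish.\<close>

lemma frag_extend_map_lifts:
  assumes "finite R"
  shows "frag_extend (frag_of \<circ> map p) (\<Sum>xs\<in>lifts p R A. frag_of xs)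
    = frag_cmul (int (card (lifts p R A))) (frag_of A)"
proof -
  have "frag_extend (frag_of \<circ> map p) (\<Sum>xs\<in>lifts p R A. frag_of xs)
      = (\<Sum>xs\<in>lifts p R A. frag_of (map p xs))"
    by (simp add: frag_extend_sum[OF finite_lifts[OF assms]])
  also have "\<dots> = (\<Sum>xs\<in>lifts p R A. frag_of A)"
    by (rule sum.cong) (auto simp: lifts_def)
  also have "\<dots> = frag_cmul (int (card (lifts p R A))) (frag_of A)"
    by (rule poly_mapping_eqI) (simp add: lookup_sum)
  finally show ?thesis .
qed

text \<open>One family of cycles \<open>z A\<close> and coefficients \<open>\<phi> A\<close> serves
  all three complexes; only the index set changes. A general finite \<open>R\<close> closed under
  the operation treats finite quandles and sections together.\<close>

theorem betti_ge:
  fixes p :: "'a \<Rightarrow> 'b"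
  assumes p: "\<And>x y. \<lbrakk>x \<in> X; y \<in> X\<rbrakk> \<Longrightarrow> p (x \<star> y) = p x"
    and R: "R \<subseteq> X" "finite R" "\<And>x y. \<lbrakk>x \<in> R; y \<in> R\<rbrakk> \<Longrightarrow> x \<star> y \<in> R"
    and n: "n \<ge> 1"
  defines "m \<equiv> card (p ` R)"
  shows "enat (a_seq m n) \<le> betti_D X (\<star>) n"
    and "enat (m ^ n) \<le> betti_R X (\<star>) n"
    and "enat (b_seq m n) \<le> betti_Q X (\<star>) n"
proof -
  \<comment> \<open>Entries are taken from the image of \<open>R\<close>, so that every tuple over
    \<open>Y\<close> has a lift in \<open>R\<close>.\<close>
  define Y where "Y = p ` R"
  have Y: "finite Y" "m = card Y"
    using R by (auto simp: Y_def m_def)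
  define z where "z = (\<lambda>A. \<Sum>xs\<in>lifts p R A. frag_of xs)"
  define \<phi> where "\<phi> = (\<lambda>A c. Poly_Mapping.lookup (frag_extend (frag_of \<circ> map p) c) A)"
  note finite = finite_lifts[OF R(2)]
  have keys_z: "Poly_Mapping.keys (z A) \<subseteq> lifts p R A" for A
    unfolding z_def using keys_sum[of "\<lambda>xs. frag_of xs" "lifts p R A"] by auto
  have z_R: "z A \<in> carrier (CR X n)" if "A \<in> tuples Y n" for A
    using keys_z lifts_subset_tuples[OF R(1) that] by (auto simp: CR_def)
  have z_D: "z A \<in> carrier (CD X n)" if "A \<in> degenerate_tuples Y n" for A
    using keys_z lifts_subset_degenerate_tuples[OF R(1) that] by (auto simp: CD_eq)
  have bd_z: "bdR (\<star>) n (z A) = 0" if "A \<in> tuples Y n" for A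
    unfolding z_def
  proof (rule bdR_sum_invariant[OF finite lifts_subset_tuples[OF R(1) that]])
    have "length A = n"
      using that by (auto simp: tuples_def split: if_splits)
    then show "map (\<lambda>x. x \<star> xs ! j) (take (Suc j) xs) @ drop (Suc j) xs \<in> lifts p R A"
      if "xs \<in> lifts p R A" "j < n" for xs j
      using lifts_invariant[OF p R(1,3) that(1)] that(2) by simp
  qed
  have \<phi>_z: "\<phi> A (z B) = (if A = B then int (card (lifts p R B)) else 0)" for A B
    by (simp add: \<phi>_def z_def frag_extend_map_lifts[OF R(2)])
  have \<phi>_diag: "\<phi> A (z A) \<noteq> 0" if "A \<in> tuples Y n" for A
  proof -
    have "set A \<subseteq> p ` R"
      using that by (auto simp: tuples_def Y_def split: if_splits)
    then have "lifts p R A \<noteq> {}"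
      by (rule lifts_nonempty)
    then show ?thesis
      using \<phi>_z finite by (simp add: card_eq_0_iff)
  qed
  have \<phi>_off: "\<phi> A (z B) = 0" if "A \<noteq> B" for A B
    using that \<phi>_z by simp
  have \<phi>_bd: "\<phi> A (bdR (\<star>) (Suc n) c) = 0" if "c \<in> carrier (CR X (Suc n))" for A c
    using frag_extend_map_bdR[OF p, of c "Suc n"] that by (simp add: \<phi>_def CR_def)
  have CD_sub: "c \<in> carrier (CR X k)" if "c \<in> carrier (CD X k)" for c k
    using that subgroup.subset[OF subgroup_CD] by blast
  have group_R: "group (CR X k)" and group_D: "group (CD X k)" and group_Q: "group (CQ X k)" for k
    by (intro comm_group.axioms(2) comm_group_CR comm_group_CD comm_group_CQ)+
  have \<phi>_hom: "\<phi> A \<in> hom (CR X n) integer_group" for A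
    unfolding \<phi>_def CR_def by (rule lookup_hom_integer_group)

  \<comment> \<open>Rack complex: all tuples over \<open>Y\<close> are indices.\<close>
  have "enat (card (tuples Y n)) \<le> abelian_rank (homology (CR X) (bdR (\<star>)) n)"
    by (rule abelian_rank_homology_ge[of _ _ _ _ \<phi> z])
       (use comm_group_CR group_R bdR_hom_CR bdR_hom_CR[of "Suc n"] finite_tuples[OF Y(1)]
          \<phi>_hom \<phi>_bd \<phi>_diag \<phi>_off z_R bd_z in \<open>simp_all add: CR_def\<close>)
  then show "enat (m ^ n) \<le> betti_R X (\<star>) n"
    by (simp add: betti_R_def HR_def card_tuples[OF Y(1) n] Y(2))

  \<comment> \<open>Degenerate complex: the same data restricted to degenerate \<open>A\<close>, for
    which \<open>z A\<close> is a degenerate chain.\<close>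
  have "enat (card (degenerate_tuples Y n)) \<le> abelian_rank (homology (CD X) (bdR (\<star>)) n)"
  proof (rule abelian_rank_homology_ge[of _ _ _ _ \<phi> z])
    show "finite (degenerate_tuples Y n)"
      by (rule finite_subset[OF _ finite_tuples[OF Y(1)]]) (auto simp: degenerate_tuples_def)
    show "\<phi> A \<in> hom (CD X n) integer_group" for A
      unfolding \<phi>_def CD_eq by (rule lookup_hom_integer_group)
    show "bdR (\<star>) n (z A) = \<one>\<^bsub>CD X (n - 1)\<^esub>" if "A \<in> degenerate_tuples Y n" for A
      using bd_z that by (auto simp: CD_eq degenerate_tuples_def)
    show "\<phi> A (z A) \<noteq> 0" if "A \<in> degenerate_tuples Y n" for A
      using \<phi>_diag that by (auto simp: degenerate_tuples_def)
  qed (use comm_group_CD group_D bdR_hom_CD bdR_hom_CD[of "Suc n"] \<phi>_bd CD_sub \<phi>_off z_D in simp_all)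
  then show "enat (a_seq m n) \<le> betti_D X (\<star>) n"
    by (simp add: betti_D_def HD_def card_degenerate_tuples[OF Y(1) n] Y(2))

  \<comment> \<open>Quandle complex: for the remaining, nondegenerate \<open>A\<close>, the
    coefficient \<open>\<phi> A\<close> has to be factored through the quotient.\<close>
  let ?I = "tuples Y n - degenerate_tuples Y n"
  let ?coset = "\<lambda>c. carrier (CD X n) #>\<^bsub>CR X n\<^esub> c"
  have "\<exists>g. g \<in> hom (CQ X n) integer_group \<and> (\<forall>c\<in>carrier (CR X n). g (?coset c) = \<phi> A c)"
    if A: "A \<in> ?I" for A
  proof -
    have "\<phi> A c = 0" if c: "c \<in> carrier (CD X n)" for c
    proof -
      \<comment> \<open>Equal neighbours have equal images, so no degenerate tuple lies over a
        nondegenerate \<open>A\<close>.\<close>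
      have "map p xs \<noteq> A" if "xs \<in> degenerate_tuples X n" for xs
      proof -
        have "distinct_adj A"
          using A by (simp add: degenerate_tuples_eq)
        then show ?thesis
          using that distinct_adj_mapD[of p xs] by (auto simp: degenerate_tuples_eq)
      qed
      then have "A \<notin> Poly_Mapping.keys (frag_extend (frag_of \<circ> map p) c)"
        using keys_frag_extend[of "frag_of \<circ> map p" c] c by (fastforce simp: CD_eq)
      then show ?thesis
        by (simp add: \<phi>_def in_keys_iff)
    qed
    then obtain g where "g \<in> hom (CQ X n) integer_group"
      "\<And>c. c \<in> carrier (CR X n) \<Longrightarrow> g (?coset c) = \<phi> A c"
      using CQ_universal[OF group_integer_group \<phi>_hom[of A]] by auto
    then show ?thesis by blast
  qed
  then have "\<forall>A\<in>?I. \<exists>g. g \<in> hom (CQ X n) integer_group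
      \<and> (\<forall>c\<in>carrier (CR X n). g (?coset c) = \<phi> A c)"
    by blast
  from bchoice[OF this] obtain \<psi> where \<psi>': "\<forall>A\<in>?I. \<psi> A \<in> hom (CQ X n) integer_group
      \<and> (\<forall>c\<in>carrier (CR X n). \<psi> A (?coset c) = \<phi> A c)" ..
  have \<psi>: "\<psi> A \<in> hom (CQ X n) integer_group"
    and \<psi>_coset: "c \<in> carrier (CR X n) \<Longrightarrow> \<psi> A (?coset c) = \<phi> A c" if "A \<in> ?I" for A c
    using \<psi>' that by blast+
  have "enat (card ?I) \<le> abelian_rank (homology (CQ X) (bdQ X (\<star>)) n)"
  proof (rule abelian_rank_homology_ge[of _ _ _ _ \<psi> "\<lambda>A. ?coset (z A)"])
    show "finite ?I"
      using finite_tuples[OF Y(1)] by simp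
    show "\<psi> A (bdQ X (\<star>) (Suc n) K) = 0" if A: "A \<in> ?I" and K: "K \<in> carrier (CQ X (Suc n))" for A K
    proof -
      obtain c where c: "c \<in> carrier (CR X (Suc n))" "K = carrier (CD X (Suc n)) #>\<^bsub>CR X (Suc n)\<^esub> c"
        using K by (auto simp: CQ_def carrier_FactGroup)
      then have "bdQ X (\<star>) (Suc n) K = ?coset (bdR (\<star>) (Suc n) c)"
        using bdQ_coset[OF c(1)] by simp
      moreover have "bdR (\<star>) (Suc n) c \<in> carrier (CR X n)"
        using hom_in_carrier[OF bdR_hom_CR c(1)] by simp
      ultimately show ?thesis
        using \<psi>_coset[OF A] \<phi>_bd[OF c(1)] by simp
    qed
    show "?coset (z A) \<in> carrier (CQ X n)" if "A \<in> ?I" for A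
      using that z_R by (auto simp: CQ_def carrier_FactGroup)
    show "bdQ X (\<star>) n (?coset (z A)) = \<one>\<^bsub>CQ X (n - 1)\<^esub>" if "A \<in> ?I" for A
    proof -
      have "bdQ X (\<star>) n (?coset (z A)) = carrier (CD X (n - 1)) #>\<^bsub>CR X (n - 1)\<^esub> 0"
        using that bdQ_coset[OF z_R] bd_z by simp
      then show ?thesis
        by (simp add: CQ_def r_coset_def CR_def)
    qed
  qed (use comm_group_CQ group_Q bdQ_hom bdQ_hom[of "Suc n"] \<psi> \<psi>_coset z_R \<phi>_diag \<phi>_off in simp_all)
  then show "enat (b_seq m n) \<le> betti_Q X (\<star>) n"
    by (simp add: betti_Q_def HQ_def card_nondegenerate_tuples[OF Y(1) n] Y(2))
qed

end

theorem theorem4p1: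
  fixes X :: "'a set" and star :: "'a \<Rightarrow> 'a \<Rightarrow> 'a" and m n :: nat
  assumes "quandle X star"
    and "finite (Orb X star)"
    and "m = card (Orb X star)"
    and "finite X \<or>
         (\<exists>s :: 'a set \<Rightarrow> 'a. quandle_hom (Orb X star) trivial_star X star s \<and>
            (\<forall>A\<in>Orb X star. orb_proj X star (s A) = A))"
    and "n \<ge> 1"
  shows "betti_D X star n \<ge> enat (a_seq m n) \<and>
         betti_R X star n \<ge> enat (m ^ n) \<and>
         betti_Q X star n \<ge> enat (b_seq m n)"
proof -
  interpret quandle X star by (rule assms)
  obtain R where R: "R \<subseteq> X" "finite R" "\<And>x y. \<lbrakk>x \<in> R; y \<in> R\<rbrakk> \<Longrightarrow> star x y \<in> R"
    "orb_proj X star ` R = Orb X star"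
    using assms(4)
  proof (elim disjE exE conjE)
    assume "finite X"
    then show thesis
      using that[of X] star_closed Orb_eq by simp
  next
    fix s assume s: "quandle_hom (Orb X star) trivial_star X star s"
      "\<forall>A\<in>Orb X star. orb_proj X star (s A) = A"
    show thesis
    proof (rule that[of "s ` Orb X star"])
      \<comment> \<open>Being a homomorphism from a trivial quandle, \<open>s\<close> satisfies
        \<open>star (s A) (s B) = s A\<close>.\<close>
      show "star x y \<in> s ` Orb X star" if "x \<in> s ` Orb X star" "y \<in> s ` Orb X star" for x y
        using that s(1) by (force simp: quandle_hom_def trivial_star_def)
      show "orb_proj X star ` s ` Orb X star = Orb X star"
        using s(2) by (simp add: image_image)
    qed (use s(1) assms(2) in \<open>auto simp: quandle_hom_def\<close>)
  qed
  show ?thesis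
    using betti_ge[OF orb_proj_star R(1-3) assms(5)] assms(3) R(4) by simp
qed

end
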